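(* Let $I$ be an instance of Setwise-Disjoint Facility Location on an arc-weighted, strongly connected directed graph $G=(V,A)$ with customers $C\subseteq F\subseteq V$, let $1\le t\le |F|$, and suppose the set $C_t$ of $t$-good customers is nonempty. Let $\mathrm{OPT}_t(I)$ be the size of a minimum $F'\subseteq F$ such that every $c\in C_t\setminus F'$ is covered in a setwise-disjoint fashion by some pair in $F'\setminus\{c\}$. Run $\mathrm{DHS}_t$ once on $I$, producing hitting sets $X$ and $Y$ as described below. Then $$|X\cup Y|\le (\ln(|C_t|)+1)\cdot\mathrm{OPT}_t(I)+|X|,$$ and, if $t\ge |F|/3$, $$|X\cup Y|\le (3.47\cdot\ln(|C_t|)+2)\cdot\mathrm{OPT}_t(I).$$
   Context: For $c\in C$, $f\in F$, $P(c,f)$ is the set of shortest (minimum-weight) directed paths from $c$ to $f$. A pair $\{f_1,f_2\}\subseteq F\setminus\{c\}$ covers $c$ in a setwise-disjoint fashion if no path in $P(c,f_1)$ shares a vertex other than $c$ with any path in $P(c,f_2)$. $N(c)=\{x:(c,x)\in A\}$; for $f\neq c$, $N(c,f)$ is the set of $x\in N(c)$ lying on some path in $P(c,f)$. A facility $f$ is good for $c$ if $f\ne c$ and $|N(c,f)|=1$; $c$ is $t$-good if at least $t$ facilities in $F$ are good for $c$; $C_t$ is the set of $t$-good customers; $S_c=\{c\}\cup\{f\in F: f\text{ good for }c\}$. The greedy hitting set heuristic for a family of subsets of $F$ starts from the empty set and repeatedly adds an element of $F$ lying in the largest number of not-yet-hit sets (ties broken arbitrarily) until all sets are hit. $\mathrm{DHS}_t$: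 let $X$ be the greedy hitting set for $\{S_c:c\in C_t\}$. Let $C'$ be the set of $c\in C_t$ with $c\in X$ or covered in a setwise-disjoint fashion by a pair of distinct elements of $X\setminus\{c\}$, and $C''=C_t\setminus C'$. For $c\in C''$ choose $f_c\in X\cap S_c$, let $x_c$ be the unique element of $N(c,f_c)$, and let $F_c=\{c\}\cup\{f\in F\setminus\{c\}: \text{no path in } P(c,f)\text{ contains } x_c\}$. Let $Y$ be the greedy hitting set for $\{F_c: c\in C''\}$. *)

theory Defs
  imports Complex_Main "Graph_Theory.Graph_Theory"
begin

section \<open>The greedy hitting set heuristic\<close>

definition unhit :: "'a set set \<Rightarrow> 'a set \<Rightarrow> 'a set set" where
  "unhit \<S> H = {S \<in> \<S>. S \<inter> H = {}}"

text \<open>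
  The sets that the heuristic can reach; ties are broken nondeterministically.
\<close>
inductive greedy_reach :: "'a set \<Rightarrow> 'a set set \<Rightarrow> 'a set \<Rightarrow> bool" for F \<S> where
  start: "greedy_reach F \<S> {}"
| step: "greedy_reach F \<S> (insert x H)"
    if "greedy_reach F \<S> H" and "unhit \<S> H \<noteq> {}" and "x \<in> F"
      and "\<forall>y\<in>F. card {S \<in> unhit \<S> H. y \<in> S} \<le> card {S \<in> unhit \<S> H. x \<in> S}"

definition greedy_hitting_set :: "'a set \<Rightarrow> 'a set set \<Rightarrow> 'a set \<Rightarrow> bool" where
  "greedy_hitting_set F \<S> H \<longleftrightarrow> greedy_reach F \<S> H \<and> unhit \<S> H = {}"

section \<open>Setwise-Disjoint Facility Location\<close>

text \<open>
  No sign condition is imposed on the arc weights. Paths are simple, so minimum-weight paths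
  exist whatever the signs.
\<close>
locale sdfl = pair_fin_digraph G for G :: "'v pair_pre_digraph" +
  fixes w :: "('v \<times> 'v) weight_fun" and C F :: "'v set"
  assumes strongly_connected: "strongly_connected (with_proj G)"
    and customers_facilities: "C \<subseteq> F"
    and facilities_verts: "F \<subseteq> pverts G"
begin

definition shortest_paths :: "'v \<Rightarrow> 'v \<Rightarrow> ('v \<times> 'v) awalk set" where
  "shortest_paths c f =
     {p. apath c p f \<and> (\<forall>q. apath c q f \<longrightarrow> awalk_cost w p \<le> awalk_cost w q)}"

definition covers :: "'v \<Rightarrow> 'v \<Rightarrow> 'v \<Rightarrow> bool" where
  "covers f1 f2 c \<longleftrightarrow>
     (\<forall>p \<in> shortest_paths c f1. \<forall>q \<in> shortest_paths c f2.
        set (pawalk_verts c p) \<inter> set (pawalk_verts c q) \<subseteq> {c})"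

definition covered_by :: "'v set \<Rightarrow> 'v \<Rightarrow> bool" where
  "covered_by H c \<longleftrightarrow> (\<exists>f1 \<in> H - {c}. \<exists>f2 \<in> H - {c}. f1 \<noteq> f2 \<and> covers f1 f2 c)"

definition nbrs :: "'v \<Rightarrow> 'v set" where
  "nbrs c = {x. (c, x) \<in> parcs G}"

definition nbrs_toward :: "'v \<Rightarrow> 'v \<Rightarrow> 'v set" where
  "nbrs_toward c f = {x \<in> nbrs c. \<exists>p \<in> shortest_paths c f. x \<in> set (pawalk_verts c p)}"

definition good :: "'v \<Rightarrow> 'v \<Rightarrow> bool" where
  "good c f \<longleftrightarrow> f \<noteq> c \<and> card (nbrs_toward c f) = 1"

definition t_good :: "nat \<Rightarrow> 'v set" where
  "t_good t = {c \<in> C. t \<le> card {f \<in> F. good c f}}"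

definition good_set :: "'v \<Rightarrow> 'v set" where
  "good_set c = {c} \<union> {f \<in> F. good c f}"

definition OPT :: "nat \<Rightarrow> nat" where
  "OPT t = Min (card ` {F'. F' \<subseteq> F \<and> (\<forall>c \<in> t_good t - F'. covered_by F' c)})"

definition uncovered :: "nat \<Rightarrow> 'v set \<Rightarrow> 'v set" where
  "uncovered t X = t_good t - {c \<in> t_good t. c \<in> X \<or> covered_by X c}"

definition avoid_set :: "'v \<Rightarrow> 'v \<Rightarrow> 'v set" where
  "avoid_set c x = {c} \<union> {f \<in> F - {c}. \<forall>p \<in> shortest_paths c f. x \<notin> set (pawalk_verts c p)}"

text \<open>
  \<open>DHS t X Y\<close> holds iff some run of the algorithm, over all tie-breaking in the two greedy phases
  and all choices \<open>g c\<close> of a good facility for each still uncovered \<open>c\<close>, produces \<open>X\<close> and \<open>Y\<close>.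
  An uncovered \<open>c\<close> is not in \<open>X\<close>, so \<open>g c\<close> is good for \<open>c\<close> and \<open>the_elem\<close> is applied
  to a singleton. Both families are sets of sets: equal sets arising from different customers
  count once in the greedy choice.
\<close>
definition DHS :: "nat \<Rightarrow> 'v set \<Rightarrow> 'v set \<Rightarrow> bool" where
  "DHS t X Y \<longleftrightarrow>
     greedy_hitting_set F (good_set ` t_good t) X \<and>
     (\<exists>g. (\<forall>c \<in> uncovered t X. g c \<in> X \<inter> good_set c) \<and>
       greedy_hitting_set F
         ((\<lambda>c. avoid_set c (the_elem (nbrs_toward c (g c)))) ` uncovered t X) Y)"

end

end

theory Submission
  imports Defs "HOL-Analysis.Harmonic_Numbers"
begin

text \<open>
  If every set of a family meets \<open>K\<close> in at least \<open>m\<close> points, then by averaging over \<open>K\<close> a greedy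
  choice hits at least the fraction \<open>m / card K\<close> of the sets not yet hit, so the logarithm of their
  number drops at a fixed rate. In the first phase every set has at least \<open>t\<close> elements: take
  \<open>K = F\<close>, \<open>m = t\<close>, with rate at least \<open>ln (3/2) \<ge> 1 / 2.47\<close> when \<open>t \<ge> card F / 3\<close>. In the second
  phase take for \<open>K\<close> an optimal solution and \<open>m = 1\<close>: it hits every \<open>F\<^sub>c\<close>, since two facilities that
  cover \<open>c\<close> cannot both have a shortest path through \<open>x\<^sub>c\<close>, as \<open>x\<^sub>c \<noteq> c\<close>.
\<close>

section \<open>Greedy hitting sets: double counting and a logarithmic potential\<close>

lemma sum_card_containing:
  assumes "finite K" "finite \<U>"
  shows "(\<Sum>y\<in>K. card {S \<in> \<U>. y \<in> S}) = (\<Sum>S\<in>\<U>. card (S \<inter> K))"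
proof -
  have "card (S \<inter> K) = card {y \<in> K. y \<in> S}" for S
    by (rule arg_cong[where f = card]) auto
  then show ?thesis
    using sum.swap_restrict[OF assms, of "\<lambda>_ _. 1::nat" "\<lambda>y S. y \<in> S"] by simp
qed

text \<open>Count incidences between \<open>\<U>\<close> and \<open>K\<close>: each set contributes
  at least \<open>m\<close>, while each point of \<open>K\<close>, being a candidate in
  \<open>F\<close>, contributes at most as much as the greedy choice \<open>x\<close>. The point
  \<open>x\<close> itself may lie outside \<open>K\<close>.\<close>

lemma greedy_step_bound:
  assumes "finite \<U>" "finite K" "K \<subseteq> F"
    and meet: "\<And>S. S \<in> \<U> \<Longrightarrow> m \<le> card (S \<inter> K)"
    and greedy: "\<forall>y\<in>F. card {S \<in> \<U>. y \<in> S} \<le> card {S \<in> \<U>. x \<in> S}"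
  shows "m * card \<U> \<le> card K * card {S \<in> \<U>. x \<in> S}"
proof -
  have "m * card \<U> \<le> (\<Sum>S\<in>\<U>. card (S \<inter> K))"
    using sum_bounded_below[of \<U> m "\<lambda>S. card (S \<inter> K)"] meet by (simp add: mult.commute)
  also have "\<dots> = (\<Sum>y\<in>K. card {S \<in> \<U>. y \<in> S})"
    by (simp add: sum_card_containing assms)
  also have "\<dots> \<le> card K * card {S \<in> \<U>. x \<in> S}"
    using sum_bounded_above[of K "\<lambda>y. card {S \<in> \<U>. y \<in> S}" "card {S \<in> \<U>. x \<in> S}"]
      greedy \<open>K \<subseteq> F\<close> by (simp add: subset_iff)
  finally show ?thesis .
qed

lemma unhit_insert: "unhit \<S> (insert x H) = unhit \<S> H - {S \<in> unhit \<S> H. x \<in> S}"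
  by (auto simp: unhit_def)

text \<open>
  The potential \<open>a * ln u + b\<close> of the number \<open>u\<close> of unhit sets, read as \<open>0\<close> for \<open>u = 0\<close>,
  drops by at least \<open>1\<close> in each greedy step.
\<close>
lemma greedy_reach_potential:
  assumes "greedy_reach F \<S> H" "finite \<S>" "\<S> \<noteq> {}" "finite K" "K \<subseteq> F"
    and meet: "\<And>S. S \<in> \<S> \<Longrightarrow> m \<le> card (S \<inter> K)"
    and "0 < a" "1 \<le> b" and rate: "1 - real m / real (card K) \<le> exp (- 1 / a)"
  shows "real (card H) + (if unhit \<S> H = {} then 0 else a * ln (card (unhit \<S> H)) + b)
           \<le> a * ln (card \<S>) + b"
  using assms(1)
proof induction
  case start
  have "unhit \<S> {} = \<S>" by (auto simp: unhit_def)
  then show ?case using \<open>\<S> \<noteq> {}\<close> by simp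
next
  case (step H x)
  define u u' where "u = card (unhit \<S> H)" and "u' = card (unhit \<S> (insert x H))"
  define d where "d = card {S \<in> unhit \<S> H. x \<in> S}"
  have fin: "finite (unhit \<S> H')" for H'
    using \<open>finite \<S>\<close> by (simp add: unhit_def)
  have "u > 0" using fin step.hyps(2) by (simp add: u_def card_gt_0_iff)
  have IH: "card H + (a * ln u + b) \<le> a * ln (card \<S>) + b"
    using step.IH step.hyps(2) by (simp add: u_def)
  have card_insert: "real (card (insert x H)) \<le> card H + 1"
    using card_insert_le_m1[of "Suc (card H)" H x] by simp
  show ?case
  proof (cases "unhit \<S> (insert x H) = {}")
    case True
    \<comment> \<open>In the last step the potential falls to \<open>0\<close>; since
      \<open>u\<close> is at least \<open>1\<close>, what is lost is at least \<open>b\<close>,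
      which pays for the new element.\<close>
    have "0 \<le> a * ln u" using \<open>u > 0\<close> \<open>0 < a\<close> by simp
    then show ?thesis using True IH card_insert \<open>1 \<le> b\<close> by simp
  next
    case False
    then have "u' > 0" using fin by (simp add: u'_def card_gt_0_iff)
    \<comment> \<open>For \<open>card K = 0\<close> the quotient in \<open>rate\<close> is
      \<open>0\<close> by convention, which would force
      \<open>1 \<le> exp (- 1 / a)\<close>.\<close>
    have "card K > 0"
    proof (rule ccontr)
      assume "\<not> card K > 0"
      then have "1 \<le> exp (- 1 / a)" using rate by simp
      then show False using \<open>0 < a\<close> by (simp add: divide_simps)
    qed
    have "m * u \<le> card K * d"
      unfolding u_def d_def
      by (rule greedy_step_bound[OF fin \<open>finite K\<close> \<open>K \<subseteq> F\<close> meet step.hyps(4)])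
         (auto simp: unhit_def)
    then have "real m * u \<le> card K * real d"
      by (metis of_nat_le_iff of_nat_mult)
    then have "real m / card K * u \<le> d"
      using \<open>card K > 0\<close> by (simp add: field_simps)
    moreover have "u = u' + d"
      unfolding u_def u'_def d_def unhit_insert using fin
      by (subst card_Diff_subset) (auto intro!: le_add_diff_inverse2[symmetric] card_mono)
    ultimately have "real u' \<le> (1 - real m / card K) * u"
      by (simp add: algebra_simps)
    also have "\<dots> \<le> exp (- 1 / a) * u"
      using rate by (intro mult_right_mono) auto
    finally have "ln u' \<le> ln (exp (- 1 / a) * u)"
      using \<open>u' > 0\<close> \<open>u > 0\<close> by (subst ln_le_cancel_iff) auto
    also have "\<dots> = - 1 / a + ln u"
      using \<open>u > 0\<close> by (simp add: ln_mult)
    finally have "a * ln u' + 1 \<le> a * ln u"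
      using \<open>0 < a\<close> by (simp add: field_simps)
    then show ?thesis using False IH card_insert by (simp add: u'_def)
  qed
qed

lemma greedy_hitting_set_card_le:
  assumes "greedy_hitting_set F \<S> H" "finite \<S>" "\<S> \<noteq> {}" "finite K" "K \<subseteq> F"
    and "\<And>S. S \<in> \<S> \<Longrightarrow> m \<le> card (S \<inter> K)"
    and "0 < a" "1 \<le> b" "1 - real m / real (card K) \<le> exp (- 1 / a)"
  shows "real (card H) \<le> a * ln (card \<S>) + b"
proof -
  have "greedy_reach F \<S> H" and "unhit \<S> H = {}"
    using assms(1) by (auto simp: greedy_hitting_set_def)
  then show ?thesis
    using greedy_reach_potential[OF \<open>greedy_reach F \<S> H\<close> assms(2-)] by simp
qed

lemma greedy_hitting_set_empty:
  assumes "greedy_hitting_set F {} H"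
  shows "H = {}"
  using assms by (auto simp: greedy_hitting_set_def unhit_def elim: greedy_reach.cases)

text \<open>The potential bound with \<open>m = 1\<close> and \<open>a = b = card K\<close>; the
  rate is \<open>1 + z \<le> exp z\<close> at \<open>z = - 1 / card K\<close>. The bound
  \<open>n\<close> is meant for the number of customers, several of which may give the same
  set.\<close>

lemma greedy_hitting_set_card_le_hitting_set:
  assumes "greedy_hitting_set F \<S> H" "finite \<S>" "finite K" "K \<subseteq> F"
    and hit: "\<And>S. S \<in> \<S> \<Longrightarrow> S \<inter> K \<noteq> {}" and "card \<S> \<le> n" "0 < n"
  shows "real (card H) \<le> (ln n + 1) * card K"
proof (cases "\<S> = {}")
  case True
  then show ?thesis using assms(1) \<open>0 < n\<close> greedy_hitting_set_empty by fastforce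
next
  case False
  then have "card K > 0" using hit \<open>finite K\<close> by (auto simp: card_gt_0_iff)
  have "card \<S> > 0" using False \<open>finite \<S>\<close> by (simp add: card_gt_0_iff)
  have "1 \<le> card (S \<inter> K)" if "S \<in> \<S>" for S
    using hit[OF that] \<open>finite K\<close> by (simp add: Suc_le_eq card_gt_0_iff)
  moreover have "1 - real 1 / card K \<le> exp (- 1 / card K)"
    using exp_ge_add_one_self[of "- 1 / card K"] by simp
  ultimately have "card H \<le> card K * ln (card \<S>) + card K"
    using \<open>card K > 0\<close>
    by (intro greedy_hitting_set_card_le[OF assms(1,2) False assms(3,4), where m = 1]) auto
  also have "\<dots> \<le> card K * ln n + card K"
    using \<open>card \<S> \<le> n\<close> \<open>card \<S> > 0\<close> by (simp add: mult_left_mono)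
  finally show ?thesis by (simp add: algebra_simps)
qed

text \<open>The fraction 2/3 is what a greedy step leaves at most when every set contains a third of
  the facilities; 2.47 is 1 / ln (3/2) rounded up.\<close>

lemma two_thirds_le_exp: "(2/3 :: real) \<le> exp (- 1 / 2.47)"
proof -
  have "1 / 2.47 \<le> ln (3/2 :: real)"
    \<comment> \<open>Two terms of the logarithm series in (x - 1)/(x + 1) = 1/5 give more than
      0.4053, and 1/2.47 < 0.4049. One term gives only 0.4.\<close>
    using ln_approx_bounds[of "3/2" 2] by (simp add: eval_nat_numeral)
  then have "exp (1 / 2.47) \<le> (3/2 :: real)"
    using ln_ge_iff[of "3/2" "1 / 2.47"] by linarith
  then show ?thesis by (simp add: exp_minus field_simps)
qed

section \<open>Shortest paths and feasible solutions\<close>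

context sdfl
begin

lemma finite_facilities: "finite F"
  by (rule finite_subset[OF facilities_verts pair_finite_verts])

lemma t_good_subset: "t_good t \<subseteq> F"
  using customers_facilities by (auto simp: t_good_def)

text \<open>Strong connectivity gives a simple path, and there are only finitely many, so a minimum
  is attained for arbitrary weights.\<close>

lemma shortest_path_exists:
  assumes "c \<in> F" "f \<in> F"
  shows "\<exists>p. p \<in> shortest_paths c f"
proof -
  have "c \<rightarrow>\<^sup>*\<^bsub>with_proj G\<^esub> f"
    using strongly_connected facilities_verts assms
    unfolding strongly_connected_def with_proj_simps(1) by blast
  then have "{p. apath c p f} \<noteq> {}" by (simp add: reachable_apath)
  then obtain p where "is_arg_min (awalk_cost w) (\<lambda>p. p \<in> {p. apath c p f}) p"
    using ex_is_arg_min_if_finite[OF apaths_finite] by blast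
  then show ?thesis by (auto simp: shortest_paths_def is_arg_min_linorder)
qed

text \<open>
  The second vertex of a shortest path differs from \<open>c\<close> because paths are simple; so a loop at \<open>c\<close>,
  which puts \<open>c\<close> into \<open>nbrs c\<close>, cannot make \<open>c\<close> the unique neighbour.
\<close>
lemma good_unique_nbr_neq:
  assumes "c \<in> F" "f \<in> F" "good c f"
  shows "the_elem (nbrs_toward c f) \<noteq> c"
proof -
  obtain p where p: "p \<in> shortest_paths c f" using shortest_path_exists assms by blast
  then have ap: "apath c p f" by (simp add: shortest_paths_def)
  have "f \<noteq> c" using \<open>good c f\<close> by (simp add: good_def)
  then obtain e es where pe: "p = e # es"
    using ap by (cases p) (auto simp: apath_def awalk_Nil_iff)
  then have e: "e \<in> parcs G" "fst e = c" "apath (snd e) es f" "c \<notin> set (pawalk_verts (snd e) es)"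
    using ap by (auto simp: apath_Cons_iff)
  moreover from e have x: "snd e \<in> set (pawalk_verts (snd e) es)"
    by (cases es) (auto simp: apath_def)
  ultimately have "snd e \<noteq> c" "snd e \<in> set (pawalk_verts c p)" "(c, snd e) \<in> parcs G"
    using pe by auto
  then have "snd e \<noteq> c" "snd e \<in> nbrs_toward c f"
    using p by (auto simp: nbrs_toward_def nbrs_def)
  moreover obtain x where "nbrs_toward c f = {x}"
    using \<open>good c f\<close> by (auto simp: good_def card_1_singleton_iff)
  ultimately show ?thesis by auto
qed

text \<open>The minimum is taken over a nonempty family: \<open>F\<close> is feasible, because it
  contains every customer and so has nobody left to cover.\<close>

lemma optimal_solution:
  obtains F' where "F' \<subseteq> F" "\<forall>c \<in> t_good t - F'. covered_by F' c" "card F' = OPT t"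
proof -
  let ?A = "{F'. F' \<subseteq> F \<and> (\<forall>c \<in> t_good t - F'. covered_by F' c)}"
  have "F \<in> ?A" using t_good_subset by auto
  moreover have "finite ?A" using finite_facilities by simp
  ultimately have "OPT t \<in> card ` ?A" unfolding OPT_def by (intro Min_in) auto
  then show ?thesis using that by auto
qed

lemma solution_hits_avoid_set:
  assumes "F' \<subseteq> F" "c \<in> F' \<or> covered_by F' c" "x \<noteq> c"
  shows "avoid_set c x \<inter> F' \<noteq> {}"
proof (cases "c \<in> F'")
  case True
  moreover have "c \<in> avoid_set c x" by (simp add: avoid_set_def)
  ultimately show ?thesis by blast
next
  case False
  then obtain f1 f2 where f: "f1 \<in> F' - {c}" "f2 \<in> F' - {c}" "covers f1 f2 c"
    using assms by (auto simp: covered_by_def)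
  then have "f1 \<in> avoid_set c x \<or> f2 \<in> avoid_set c x"
    using assms by (fastforce simp: covers_def avoid_set_def)
  then show ?thesis using f by auto
qed

text \<open>The empty set covers no customer. Positivity later lets a bound free of
  \<open>OPT t\<close> be multiplied by it.\<close>

lemma OPT_pos:
  assumes "t_good t \<noteq> {}"
  shows "0 < OPT t"
proof (rule ccontr)
  assume "\<not> 0 < OPT t"
  moreover obtain F' where "F' \<subseteq> F" "\<forall>c \<in> t_good t - F'. covered_by F' c" "card F' = OPT t"
    by (rule optimal_solution)
  moreover from this have "finite F'" using finite_facilities finite_subset by blast
  ultimately show False using assms by (auto simp: covered_by_def)
qed

section \<open>The two phases and their sum\<close>

lemma first_phase_bound:
  assumes "greedy_hitting_set F (good_set ` t_good t) X" "t_good t \<noteq> {}" "card F / 3 \<le> real t"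
  shows "card X \<le> 2.47 * ln (card (t_good t)) + 1"
proof -
  have fin: "finite (t_good t)" using t_good_subset finite_facilities finite_subset by blast
  have "card F > 0" using assms(2) t_good_subset finite_facilities by (auto simp: card_gt_0_iff)
  have "t \<le> card (S \<inter> F)" if S: "S \<in> good_set ` t_good t" for S
  proof -
    obtain c where c: "c \<in> t_good t" "S = good_set c" using S by blast
    then have "t \<le> card {f \<in> F. good c f}" by (simp add: t_good_def)
    also have "\<dots> \<le> card (S \<inter> F)"
      using c finite_facilities by (intro card_mono) (auto simp: good_set_def)
    finally show ?thesis .
  qed
  moreover have "1 - real t / card F \<le> exp (- 1 / 2.47)"
  proof -
    have "1/3 \<le> real t / card F" using assms(3) \<open>card F > 0\<close> by (simp add: field_simps)
    then show ?thesis using two_thirds_le_exp by linarith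
  qed
  ultimately have "card X \<le> 2.47 * ln (card (good_set ` t_good t)) + 1"
    using fin assms finite_facilities
    by (intro greedy_hitting_set_card_le[where K = F and m = t and F = F]) auto
  also have "ln (card (good_set ` t_good t)) \<le> ln (card (t_good t))"
    using fin assms(2) card_image_le[OF fin, of good_set] by (simp add: card_gt_0_iff)
  finally show ?thesis by simp
qed

lemma second_phase_bound:
  assumes "DHS t X Y" "t_good t \<noteq> {}"
  shows "card Y \<le> (ln (card (t_good t)) + 1) * OPT t"
proof -
  obtain g where g: "\<And>c. c \<in> uncovered t X \<Longrightarrow> g c \<in> X \<inter> good_set c"
    and Y: "greedy_hitting_set F
      ((\<lambda>c. avoid_set c (the_elem (nbrs_toward c (g c)))) ` uncovered t X) Y"
    using assms(1) by (auto simp: DHS_def)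
  obtain F' where F': "F' \<subseteq> F" "\<forall>c \<in> t_good t - F'. covered_by F' c" "card F' = OPT t"
    by (rule optimal_solution)
  have fin: "finite (t_good t)" using t_good_subset finite_facilities finite_subset by blast
  have sub: "uncovered t X \<subseteq> t_good t" by (auto simp: uncovered_def)
  have hit: "avoid_set c (the_elem (nbrs_toward c (g c))) \<inter> F' \<noteq> {}" if c: "c \<in> uncovered t X" for c
  proof (rule solution_hits_avoid_set[OF F'(1)])
    show "c \<in> F' \<or> covered_by F' c" using F'(2) c sub by auto
    \<comment> \<open>This excludes \<open>g c = c\<close>, the one element of
      \<open>good_set c\<close> that need not be good.\<close>
    have "c \<notin> X" using c by (auto simp: uncovered_def)
    then have "g c \<in> F" "good c (g c)" using g[OF c] by (auto simp: good_set_def)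
    then show "the_elem (nbrs_toward c (g c)) \<noteq> c"
      using good_unique_nbr_neq c sub t_good_subset by blast
  qed
  have "finite (uncovered t X)" "finite F'"
    using fin sub F'(1) finite_facilities finite_subset by blast+
  moreover have "card ((\<lambda>c. avoid_set c (the_elem (nbrs_toward c (g c)))) ` uncovered t X)
      \<le> card (t_good t)"
    using card_image_le[OF \<open>finite (uncovered t X)\<close>] card_mono[OF fin sub] le_trans by blast
  moreover have "0 < card (t_good t)"
    using fin assms(2) by (simp add: card_gt_0_iff)
  moreover have "S \<inter> F' \<noteq> {}"
    if "S \<in> (\<lambda>c. avoid_set c (the_elem (nbrs_toward c (g c)))) ` uncovered t X" for S
    using that hit by blast
  ultimately show ?thesis
    using greedy_hitting_set_card_le_hitting_set[OF Y finite_imageI _ F'(1), of "card (t_good t)"]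
    unfolding F'(3) by blast
qed

end

theorem theorem5:
  fixes G :: "'v pair_pre_digraph" and w :: "('v \<times> 'v) weight_fun"
    and C F X Y :: "'v set" and t :: nat
  assumes "sdfl G C F"
    and "1 \<le> t" and "t \<le> card F"
    and "sdfl.t_good G w C F t \<noteq> {}"
    and "sdfl.DHS G w C F t X Y"
  shows "real (card (X \<union> Y)) \<le>
           (ln (real (card (sdfl.t_good G w C F t))) + 1) * real (sdfl.OPT G w C F t)
             + real (card X) \<and>
         (real t \<ge> real (card F) / 3 \<longrightarrow>
           real (card (X \<union> Y)) \<le>
             (3.47 * ln (real (card (sdfl.t_good G w C F t))) + 2) * real (sdfl.OPT G w C F t))"
proof -
  interpret sdfl G w C F by fact
  let ?L = "ln (real (card (t_good t)))"
  have union: "real (card (X \<union> Y)) \<le> card X + card Y"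
    using card_Un_le[of X Y] by linarith
  have Y: "card Y \<le> (?L + 1) * OPT t"
    using second_phase_bound assms by blast
  have "real (card (X \<union> Y)) \<le> (3.47 * ?L + 2) * OPT t" if "card F / 3 \<le> real t"
  proof -
    have "card (t_good t) > 0"
      using assms(4) t_good_subset finite_facilities finite_subset by (metis card_gt_0_iff)
    then have "0 \<le> ?L" by simp
    have "card X \<le> 2.47 * ?L + 1"
      using first_phase_bound that assms by (auto simp: DHS_def)
    \<comment> \<open>Since \<open>OPT t\<close> is at least \<open>1\<close>, the first phase fits
      under the same factor, and the coefficients add up as 3.47 = 2.47 + 1 and 2 = 1 + 1.\<close>
    also have "\<dots> \<le> (2.47 * ?L + 1) * OPT t"
      using OPT_pos[OF assms(4)] \<open>0 \<le> ?L\<close> mult_left_mono[of 1 "real (OPT t)" "2.47 * ?L + 1"] by simp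
    finally show ?thesis using union Y by (simp add: algebra_simps)
  qed
  then show ?thesis using union Y by simp
qed

end
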